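(* Let $k\ge 4$ be an integer and let $G$ be a $k$-connected graph with $\delta(G)\ge 3k-1$. Then $G$ contains a $k$-removable $\lceil(\delta(G)+1)/2\rceil$-matching, unless $G$ is a complete graph with an odd number of vertices.
   Context: All graphs are finite, undirected and simple. A graph $G$ is $k$-connected ($k\ge1$) if it has more than $k$ vertices and $G-S$ is connected for every vertex set $S$ with $|S|\le k-1$. $\delta(G)$ is the minimum degree of $G$. For $F\subseteq E(G)$, $G-F$ is the graph with vertex set $V(G)$ and edge set $E(G)\setminus F$. A matching is a set of pairwise vertex-disjoint edges; an $\ell$-matching is a matching with exactly $\ell$ edges. A matching $M$ in a $k$-connected graph $G$ is $k$-removable if $G-M$ is still $k$-connected. *)

theory Defs
  imports Complex_Main "HOL-Library.Disjoint_Sets"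
begin

text \<open>A graph is given by its vertex set and its edge set; an edge is the set of its two ends,
  so that there are no loops, orientations or multiple edges.\<close>

definition simple_graph :: "'a set \<Rightarrow> 'a set set \<Rightarrow> bool" where
  "simple_graph V E \<longleftrightarrow> finite V \<and> (\<forall>e\<in>E. e \<subseteq> V \<and> card e = 2)"

definition degree :: "'a set set \<Rightarrow> 'a \<Rightarrow> nat" where
  "degree E v = card {e \<in> E. v \<in> e}"

text \<open>Only meaningful for a finite nonempty vertex set, where the minimum exists.\<close>

definition min_degree :: "'a set \<Rightarrow> 'a set set \<Rightarrow> nat" where
  "min_degree V E = Min (degree E ` V)"

definition complete_graph :: "'a set \<Rightarrow> 'a set set \<Rightarrow> bool" where
  "complete_graph V E \<longleftrightarrow> E = {e. e \<subseteq> V \<and> card e = 2}"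

definition adj_rel :: "'a set set \<Rightarrow> ('a \<times> 'a) set" where
  "adj_rel E = {(u, v). {u, v} \<in> E}"

text \<open>Reachability by a walk. When all edges lie in \<open>V\<close>, every walk starting in \<open>V\<close> stays in \<open>V\<close>.\<close>

definition connected_graph :: "'a set \<Rightarrow> 'a set set \<Rightarrow> bool" where
  "connected_graph V E \<longleftrightarrow> V \<noteq> {} \<and> (\<forall>u\<in>V. \<forall>v\<in>V. (u, v) \<in> (adj_rel E)\<^sup>*)"

text \<open>The edge set of \<open>G - S\<close>, whose vertex set is \<open>V - S\<close>.\<close>

definition del_vertices :: "'a set set \<Rightarrow> 'a set \<Rightarrow> 'a set set" where
  "del_vertices E S = {e \<in> E. e \<inter> S = {}}"

text \<open>Intended for \<open>k \<ge> 1\<close> only, so the subtraction does not truncate.\<close>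

definition k_connected :: "nat \<Rightarrow> 'a set \<Rightarrow> 'a set set \<Rightarrow> bool" where
  "k_connected k V E \<longleftrightarrow>
     card V > k \<and>
     (\<forall>S. S \<subseteq> V \<and> card S \<le> k - 1 \<longrightarrow> connected_graph (V - S) (del_vertices E S))"

definition matching :: "'a set set \<Rightarrow> 'a set set \<Rightarrow> bool" where
  "matching E M \<longleftrightarrow> M \<subseteq> E \<and> disjoint M"

definition k_removable :: "nat \<Rightarrow> 'a set \<Rightarrow> 'a set set \<Rightarrow> 'a set set \<Rightarrow> bool" where
  "k_removable k V E M \<longleftrightarrow> matching E M \<and> k_connected k V (E - M)"

end

theory Submission
  imports Defs
begin

text \<open>
  Let \<open>\<delta>\<close> be the minimum degree of the graph \<open>G\<close>. A removable matching \<open>M\<close> with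
  \<open>2|M| \<le> \<delta>\<close> can always be enlarged by one edge, unless \<open>G\<close> is complete of odd order; iterating
  this from the empty matching gives the theorem. Let \<open>R\<close> be the set of vertices that \<open>M\<close> leaves
  uncovered; by parity, or because \<open>G\<close> is not complete, \<open>R\<close> has at least two vertices.

  If some edge of \<open>G[R]\<close> can be added to \<open>M\<close>, nothing is left to do. Otherwise every edge of \<open>G[R]\<close>
  is critical in \<open>G - M\<close>, that is, its deletion destroys \<open>k\<close>-connectivity, and
  then \<open>G[R]\<close> is a forest by a theorem of Mader: in a \<open>k\<close>-connected graph of minimum degree greater
  than \<open>k\<close> the critical edges span no cycle
  (lemma \<open>exists_noncritical_edge\<close>). So \<open>R\<close> contains two vertices \<open>x\<close>, \<open>y\<close> with at most two
  neighbours in \<open>R\<close>. As only \<open>2|M| \<le> \<delta>\<close> vertices lie outside \<open>R\<close>, these two are adjacent to almost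
  all vertices covered by \<open>M\<close>, and \<open>M\<close> has an edge \<open>ab\<close> whose ends are both adjacent to
  both of them. The enlarged matching is \<open>M - ab + xa + yb\<close>.

  To see that it is removable, suppose that after its removal a set \<open>S\<close> of fewer than \<open>k\<close> vertices
  separates \<open>A\<close> from \<open>B\<close>. One of the new edges \<open>xa\<close>, \<open>yb\<close> must cross; let \<open>p \<in> {x, y}\<close> be its end
  in \<open>R\<close> and say \<open>p \<in> B\<close>. As \<open>p\<close> sees almost everything outside \<open>R\<close> but only one vertex of \<open>A\<close>,
  the side \<open>A\<close> lies in \<open>R\<close> up to three vertices. Being almost a forest, \<open>A\<close> then contains a vertex
  of degree at most \<open>k + 4\<close>, which is impossible (lemma \<open>no_crossing_at_low_vertex\<close>).
\<close>

section \<open>Neighbourhoods and matchings\<close>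

definition nbrs :: "'a set set \<Rightarrow> 'a \<Rightarrow> 'a set" where
  "nbrs E v = {w. {v, w} \<in> E}"

lemma nbrs_subset: "simple_graph V E \<Longrightarrow> nbrs E v \<subseteq> V"
  by (auto simp: nbrs_def simple_graph_def)

lemma finite_nbrs: "simple_graph V E \<Longrightarrow> finite (nbrs E v)"
  by (meson nbrs_subset finite_subset simple_graph_def)

lemma not_self_nbr: "simple_graph V E \<Longrightarrow> {v, w} \<in> E \<Longrightarrow> v \<noteq> w"
  by (auto simp: simple_graph_def)

lemma degree_eq_card_nbrs:
  assumes "simple_graph V E"
  shows "degree E v = card (nbrs E v)"
proof -
  have inj: "inj_on (\<lambda>w. {v, w}) (nbrs E v)"
    by (auto simp: inj_on_def doubleton_eq_iff)
  have "{e \<in> E. v \<in> e} = (\<lambda>w. {v, w}) ` nbrs E v"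
  proof (intro set_eqI iffI)
    fix e assume e: "e \<in> {e \<in> E. v \<in> e}"
    then have "card e = 2" using assms by (auto simp: simple_graph_def)
    then obtain a b where "e = {a, b}" by (meson card_2_iff)
    then show "e \<in> (\<lambda>w. {v, w}) ` nbrs E v"
      using e by (auto simp: nbrs_def insert_commute)
  qed (auto simp: nbrs_def)
  then show ?thesis
    by (simp add: degree_def card_image[OF inj])
qed

lemma simple_graph_mono: "simple_graph V E \<Longrightarrow> F \<subseteq> E \<Longrightarrow> simple_graph V F"
  by (auto simp: simple_graph_def)

lemma disjoint_edges_eq: "disjoint M \<Longrightarrow> e \<in> M \<Longrightarrow> f \<in> M \<Longrightarrow> v \<in> e \<Longrightarrow> v \<in> f \<Longrightarrow> e = f"
  by (auto simp: pairwise_def disjnt_def)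

lemma matching_nbr_unique: "disjoint M \<Longrightarrow> {v, w} \<in> M \<Longrightarrow> {v, w'} \<in> M \<Longrightarrow> w = w'"
  using disjoint_edges_eq[of M "{v, w}" "{v, w'}" v] by (auto simp: doubleton_eq_iff)

lemma card_matching_nbrs_le:
  assumes "disjoint M"
  shows "card (nbrs M v) \<le> 1"
proof (cases "finite (nbrs M v)")
  case True
  then show ?thesis
    using matching_nbr_unique[OF assms] by (auto simp: card_le_Suc0_iff_eq nbrs_def)
qed simp

lemma card_Union_matching:
  assumes "simple_graph V E" "M \<subseteq> E" "disjoint M"
  shows "card (\<Union>M) = 2 * card M"
proof -
  have two: "\<And>e. e \<in> M \<Longrightarrow> card e = 2" using assms by (auto simp: simple_graph_def)
  then have "card (\<Union>M) = sum card M"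
    using assms(3) by (intro card_Union_disjoint) (auto intro: card_ge_0_finite)
  then show ?thesis using two by simp
qed

text \<open>Each vertex of \<open>X\<close> spoils at most one edge of the matching.\<close>

lemma exists_matching_edge_avoiding:
  assumes "disjoint M" "finite M" "finite X" "card X < card M"
  shows "\<exists>e\<in>M. e \<inter> X = {}"
proof (rule ccontr)
  assume "\<not> ?thesis"
  then have "\<forall>e\<in>M. \<exists>z. z \<in> e \<inter> X" by blast
  then obtain g where g: "\<And>e. e \<in> M \<Longrightarrow> g e \<in> e \<inter> X" by metis
  have "inj_on g M"
    by (rule inj_onI) (metis g IntD1 assms(1) disjoint_edges_eq)
  then have "card M \<le> card X"
    using g assms(3) by (intro card_inj_on_le[of g]) auto
  then show False using assms(4) by simp
qed

section \<open>Connectivity by separations\<close>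

definition separation :: "'a set \<Rightarrow> 'a set set \<Rightarrow> 'a set \<Rightarrow> 'a set \<Rightarrow> 'a set \<Rightarrow> bool" where
  "separation V E S A B \<longleftrightarrow> S \<union> A \<union> B = V \<and> S \<inter> A = {} \<and> S \<inter> B = {} \<and> A \<inter> B = {} \<and>
     A \<noteq> {} \<and> B \<noteq> {} \<and> (\<forall>u\<in>A. \<forall>v\<in>B. {u, v} \<notin> E)"

lemma separation_sym: "separation V E S A B \<Longrightarrow> separation V E S B A"
  unfolding separation_def by (metis Int_commute Un_assoc Un_commute insert_commute)

lemma separation_parts:
  assumes "separation V E S A B"
  shows "S \<union> A \<union> B = V" "S \<inter> A = {}" "S \<inter> B = {}" "A \<inter> B = {}" "A \<noteq> {}" "B \<noteq> {}"
    and "\<And>u v. u \<in> A \<Longrightarrow> v \<in> B \<Longrightarrow> {u, v} \<notin> E"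
  using assms by (auto simp: separation_def)

lemma separation_card_ge:
  assumes "simple_graph V E" "k_connected k V E" "k \<ge> 1" "separation V E S A B"
  shows "k \<le> card S"
proof (rule ccontr)
  assume "\<not> ?thesis"
  note sep = separation_parts[OF assms(4)]
  obtain u v where uv: "u \<in> A" "v \<in> B" using sep by blast
  have "connected_graph (V - S) (del_vertices E S)"
    using assms \<open>\<not> k \<le> card S\<close> sep by (auto simp: k_connected_def)
  moreover have "u \<in> V - S" "v \<in> V - S" using uv sep(1-4) by blast+
  ultimately have "(u, v) \<in> (adj_rel (del_vertices E S))\<^sup>*"
    by (simp add: connected_graph_def)
  then have "v \<in> A"
  proof (induction rule: rtrancl_induct)
    case (step y z)
    then have e: "{y, z} \<in> E" "z \<notin> S" by (auto simp: adj_rel_def del_vertices_def)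
    then have "z \<in> V" using assms(1) by (auto simp: simple_graph_def)
    then show ?case using sep step.IH e by blast
  qed (use uv in simp)
  then show False using uv sep by blast
qed

lemma k_connectedI:
  assumes "finite V" "k \<ge> 1" "card V > k"
    and nosep: "\<And>S A B. separation V E S A B \<Longrightarrow> k \<le> card S"
  shows "k_connected k V E"
  unfolding k_connected_def
proof (intro conjI allI impI)
  fix S assume S: "S \<subseteq> V \<and> card S \<le> k - 1"
  show "connected_graph (V - S) (del_vertices E S)"
    unfolding connected_graph_def
  proof (intro conjI ballI)
    show "V - S \<noteq> {}"
    proof
      assume "V - S = {}"
      then have "V = S" using S by blast
      then show False using S assms(3) by simp
    qed
  next
    fix u v assume uv: "u \<in> V - S" "v \<in> V - S"
    show "(u, v) \<in> (adj_rel (del_vertices E S))\<^sup>*"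
    proof (rule ccontr)
      assume n: "(u, v) \<notin> (adj_rel (del_vertices E S))\<^sup>*"
      define A where "A = {w \<in> V - S. (u, w) \<in> (adj_rel (del_vertices E S))\<^sup>*}"
      have "{a, b} \<notin> E" if "a \<in> A" "b \<in> V - S - A" for a b
      proof
        assume "{a, b} \<in> E"
        then have "(a, b) \<in> adj_rel (del_vertices E S)"
          using that by (auto simp: adj_rel_def del_vertices_def A_def)
        moreover have "(u, a) \<in> (adj_rel (del_vertices E S))\<^sup>*" using that by (simp add: A_def)
        ultimately have "b \<in> A" using that by (simp add: A_def rtrancl.rtrancl_into_rtrancl)
        then show False using that by blast
      qed
      then have "separation V E S A (V - S - A)"
        using S uv n by (auto simp: separation_def A_def)
      then show False using nosep S assms(2) by fastforce
    qed
  qed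
qed (use assms in simp)

lemma card_eq_sum3:
  assumes "finite X" "X \<subseteq> S \<union> A \<union> B" "S \<inter> A = {}" "S \<inter> B = {}" "A \<inter> B = {}"
  shows "card X = card (X \<inter> S) + card (X \<inter> A) + card (X \<inter> B)"
proof -
  have "card X = card ((X \<inter> S \<union> X \<inter> A) \<union> X \<inter> B)"
    by (rule arg_cong[of _ _ card]) (use assms in blast)
  also have "\<dots> = card (X \<inter> S \<union> X \<inter> A) + card (X \<inter> B)"
    by (rule card_Un_disjoint) (use assms in auto)
  also have "card (X \<inter> S \<union> X \<inter> A) = card (X \<inter> S) + card (X \<inter> A)"
    by (rule card_Un_disjoint) (use assms in auto)
  finally show ?thesis .
qed

section \<open>Critical edges span no cycle\<close>

lemma critical_edge_separation:
  assumes G: "simple_graph V E" "k_connected k V E" "k \<ge> 1"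
    and e: "e \<in> E" "\<not> k_connected k V (E - {e})"
  shows "\<exists>u v S A B. e = {u, v} \<and> u \<in> A \<and> v \<in> B \<and> card S < k \<and> separation V (E - {e}) S A B"
proof -
  have "finite V" "card V > k" using G by (auto simp: simple_graph_def k_connected_def)
  then obtain S A B where sep: "separation V (E - {e}) S A B" "card S < k"
    using k_connectedI[of V k "E - {e}"] e G(3) by (meson not_le)
  then have "\<not> separation V E S A B" using separation_card_ge[OF G] by (meson not_le)
  then obtain u v where "u \<in> A" "v \<in> B" "{u, v} \<in> E"
    using sep by (auto simp: separation_def)
  moreover then have "e = {u, v}" using sep by (auto simp: separation_def)
  ultimately show ?thesis using sep by blast
qed

text \<open>
  Uncrossing the separations \<open>(S, A, B)\<close> and \<open>(S', A', B')\<close> of two critical edges \<open>uv\<close> and \<open>uw\<close>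
  that meet in \<open>u \<in> A \<inter> A'\<close> shows that \<open>A\<close> is larger than \<open>B'\<close>. The corner \<open>A \<inter> A'\<close> has
  the boundary \<open>T\<close>, and only the two critical edges leave the corner without ending in \<open>T\<close>, both
  at \<open>u\<close>. If \<open>T\<close> had fewer than \<open>k - 1\<close> elements, then \<open>u\<close>, being of degree greater than \<open>k\<close>,
  would have a further neighbour in the corner, which \<open>T\<close> together with \<open>u\<close> would cut off. So the
  boundary \<open>T'\<close> of the opposite corner \<open>B \<inter> B'\<close> has at most \<open>k - 1\<close> elements. Neither critical
  edge meets this corner, so it is empty. If now \<open>B'\<close> were at least as large as \<open>A\<close>, then, both
  containing \<open>A \<inter> B'\<close>, the rest \<open>S \<inter> B'\<close> of \<open>B'\<close> would be larger than \<open>S' \<inter> A\<close>; but exchanging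
  these two parts turns \<open>S\<close> into \<open>T\<close>, which would be too small.
\<close>

lemma critical_sides_uncross:
  assumes G: "simple_graph V E" "k_connected k V E" "k \<ge> 1"
    and deg: "k < card (nbrs E u)"
    and sep: "separation V (E - {{u, v}}) S A B" "card S < k" "u \<in> A" "v \<in> B"
    and sep': "separation V (E - {{u, w}}) S' A' B'" "card S' < k" "u \<in> A'" "w \<in> B'"
    and uw: "{u, v} \<in> E" "{u, w} \<in> E" "v \<noteq> w"
  shows "card B' < card A"
proof (rule ccontr)
  assume "\<not> card B' < card A"
  then have le: "card A \<le> card B'" by simp
  note p = separation_parts[OF sep(1)] and p' = separation_parts[OF sep'(1)]
  have finV: "finite V" using G by (simp add: simple_graph_def)
  have fin: "finite X" if "X \<subseteq> V" for X using that finV finite_subset by blast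
  have sub: "S \<subseteq> V" "A \<subseteq> V" "B \<subseteq> V" "S' \<subseteq> V" "A' \<subseteq> V" "B' \<subseteq> V" using p(1) p'(1) by blast+
  have edgeAB: "a = u \<and> b = v" if "a \<in> A" "b \<in> B" "{a, b} \<in> E" for a b
  proof -
    have "{a, b} = {u, v}" using p(7)[OF that(1,2)] that(3) by blast
    then show ?thesis using that(1,2) sep(3,4) p(4) by (auto simp: doubleton_eq_iff)
  qed
  have edgeAB': "a = u \<and> b = w" if "a \<in> A'" "b \<in> B'" "{a, b} \<in> E" for a b
  proof -
    have "{a, b} = {u, w}" using p'(7)[OF that(1,2)] that(3) by blast
    then show ?thesis using that(1,2) sep'(3,4) p'(4) by (auto simp: doubleton_eq_iff)
  qed
  have vB': "v \<notin> B'" using edgeAB'[of u v] sep'(3) uw by blast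
  have wB: "w \<notin> B" using edgeAB[of u w] sep(3) uw by blast
  define T where "T = S \<inter> S' \<union> S \<inter> A' \<union> S' \<inter> A"
  define T' where "T' = S \<inter> S' \<union> S \<inter> B' \<union> S' \<inter> B"
  have cS: "card S = card (S \<inter> S') + card (S \<inter> A') + card (S \<inter> B')"
    by (rule card_eq_sum3) (use fin sub p'(1-4) in auto)
  have cS': "card S' = card (S \<inter> S') + card (S' \<inter> A) + card (S' \<inter> B)"
    using card_eq_sum3[of S' S A B] fin sub p(1-4) by (auto simp: Int_commute)
  have "card T = card (T \<inter> (S \<inter> S')) + card (T \<inter> (S \<inter> A')) + card (T \<inter> (S' \<inter> A))"
    by (rule card_eq_sum3) (use fin[of T] sub p(1-4) p'(1-4) in \<open>auto simp: T_def\<close>)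
  moreover have "T \<inter> (S \<inter> S') = S \<inter> S'" "T \<inter> (S \<inter> A') = S \<inter> A'" "T \<inter> (S' \<inter> A) = S' \<inter> A"
    by (auto simp: T_def)
  ultimately have cT: "card T = card (S \<inter> S') + card (S \<inter> A') + card (S' \<inter> A)" by simp
  have "card T' = card (T' \<inter> (S \<inter> S')) + card (T' \<inter> (S \<inter> B')) + card (T' \<inter> (S' \<inter> B))"
    by (rule card_eq_sum3) (use fin[of T'] sub p(1-4) p'(1-4) in \<open>auto simp: T'_def\<close>)
  moreover have "T' \<inter> (S \<inter> S') = S \<inter> S'" "T' \<inter> (S \<inter> B') = S \<inter> B'" "T' \<inter> (S' \<inter> B) = S' \<inter> B"
    by (auto simp: T'_def)
  ultimately have cT': "card T' = card (S \<inter> S') + card (S \<inter> B') + card (S' \<inter> B)" by simp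
  have finT: "finite T" by (rule fin) (use sub in \<open>auto simp: T_def\<close>)
  have bigT: "k \<le> card T + 1"
  proof (rule ccontr)
    assume small: "\<not> k \<le> card T + 1"
    have out: "z \<in> B \<or> z \<in> B'" if "z \<in> V" "z \<notin> T" "z \<notin> A \<inter> A'" for z
      using that p(1) p'(1) by (auto simp: T_def)
    have "nbrs E u \<subseteq> insert v (insert w T) \<union> (A \<inter> A' - {u})"
    proof
      fix z assume z: "z \<in> nbrs E u"
      then have "{u, z} \<in> E" "z \<noteq> u" "z \<in> V"
        using not_self_nbr[OF G(1), of u z] nbrs_subset[OF G(1)] by (auto simp: nbrs_def)
      then show "z \<in> insert v (insert w T) \<union> (A \<inter> A' - {u})"
        using out[of z] edgeAB[of u z] edgeAB'[of u z] sep(3) sep'(3) by blast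
    qed
    moreover have "card (insert v (insert w T)) \<le> k"
      using small finT by (simp add: card_insert_if)
    ultimately have ne: "A \<inter> A' - {u} \<noteq> {}"
      using deg card_mono[of "insert v (insert w T)" "nbrs E u"] finT by fastforce
    have "separation V E (insert u T) (A \<inter> A' - {u}) (V - T - A \<inter> A')"
      unfolding separation_def
    proof (intro conjI ballI)
      show "insert u T \<union> (A \<inter> A' - {u}) \<union> (V - T - A \<inter> A') = V"
        using sub sep(3) by (auto simp: T_def)
      show "insert u T \<inter> (A \<inter> A' - {u}) = {}" using p(1-4) p'(1-4) by (auto simp: T_def)
      show "insert u T \<inter> (V - T - A \<inter> A') = {}" using sep(3) sep'(3) by blast
      show "(A \<inter> A' - {u}) \<inter> (V - T - A \<inter> A') = {}" by blast
      show "A \<inter> A' - {u} \<noteq> {}" by (rule ne)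
      show "V - T - A \<inter> A' \<noteq> {}" using sep(4) p(1-4) by (auto simp: T_def)
      show "{a, b} \<notin> E" if "a \<in> A \<inter> A' - {u}" "b \<in> V - T - A \<inter> A'" for a b
        using that out[of b] edgeAB[of a b] edgeAB'[of a b] by blast
    qed
    then have "k \<le> card (insert u T)" by (rule separation_card_ge[OF G])
    then show False using small finT by (simp add: card_insert_if split: if_splits)
  qed
  have "B \<inter> B' = {}"
  proof (rule ccontr)
    assume ne: "B \<inter> B' \<noteq> {}"
    have "separation V E T' (B \<inter> B') (V - T' - B \<inter> B')"
      unfolding separation_def
    proof (intro conjI ballI)
      show "T' \<union> (B \<inter> B') \<union> (V - T' - B \<inter> B') = V" using sub by (auto simp: T'_def)
      show "T' \<inter> (B \<inter> B') = {}" using p(1-4) p'(1-4) by (auto simp: T'_def)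
      show "V - T' - B \<inter> B' \<noteq> {}" using sep(3) sep'(3) p(1-4) p'(1-4) by (auto simp: T'_def)
      show "{b, a} \<notin> E" if b: "b \<in> B \<inter> B'" and a: "a \<in> V - T' - B \<inter> B'" for a b
      proof -
        have "a \<in> A \<or> a \<in> A'" using a p(1) p'(1) by (auto simp: T'_def)
        then show ?thesis
          using b edgeAB[of a b] edgeAB'[of a b] vB' wB by (auto simp: insert_commute)
      qed
    qed (use ne in blast)+
    then have "k \<le> card T'" by (rule separation_card_ge[OF G])
    then show False using bigT cT cT' cS cS' sep(2) sep'(2) by linarith
  qed
  then have "B' \<inter> B = {}" by blast
  then have cB': "card B' = card (B' \<inter> S) + card (B' \<inter> A)"
    using card_eq_sum3[of B' S A B] fin sub p(1-4) by auto
  have cA: "card A = card (A \<inter> S') + card (A \<inter> A') + card (A \<inter> B')"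
    by (rule card_eq_sum3) (use fin sub p'(1-4) in auto)
  have "A \<inter> A' \<noteq> {}" using sep(3) sep'(3) by blast
  then have "card (A \<inter> A') > 0" using fin[of "A \<inter> A'"] sub by (auto simp: card_gt_0_iff)
  then have "card (S' \<inter> A) < card (S \<inter> B')"
    using le cB' cA by (simp add: Int_commute)
  then show False using bigT cT cS sep(2) by linarith
qed

text \<open>
  The theorem of Mader, for a set \<open>D\<close> of edges in which no vertex has degree one, such as a cycle.
  If all edges of \<open>D\<close> were critical, then a smallest side \<open>A\<close> of all their separations would
  not be smallest: the end in \<open>A\<close> of its edge lies on a second edge of \<open>D\<close>, which has a
  smaller side.
\<close>

lemma exists_noncritical_edge:
  assumes G: "simple_graph V E" "k_connected k V E" "k \<ge> 1"
    and deg: "\<And>u. u \<in> V \<Longrightarrow> k < card (nbrs E u)"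
    and D: "D \<subseteq> E" "D \<noteq> {}" "\<And>e u. e \<in> D \<Longrightarrow> u \<in> e \<Longrightarrow> \<exists>f\<in>D. f \<noteq> e \<and> u \<in> f"
  shows "\<exists>e\<in>D. k_connected k V (E - {e})"
proof (rule ccontr)
  assume crit: "\<not> ?thesis"
  define side where "side A u v \<longleftrightarrow> {u, v} \<in> D \<and> u \<in> A \<and>
    (\<exists>S B. v \<in> B \<and> card S < k \<and> separation V (E - {{u, v}}) S A B)" for A u v
  have ex: "\<exists>A u v. e = {u, v} \<and> side A u v" if "e \<in> D" for e
  proof -
    have "e \<in> E" "\<not> k_connected k V (E - {e})" using that D(1) crit by blast+
    from critical_edge_separation[OF G this] show ?thesis using that unfolding side_def by blast
  qed
  obtain A0 u0 v0 where "side A0 u0 v0" using D(2) ex by blast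
  then have "\<exists>n A u v. side A u v \<and> card A = n" by blast
  then obtain n where n: "\<exists>A u v. side A u v \<and> card A = n"
    and min: "\<And>j. j < n \<Longrightarrow> \<not> (\<exists>A u v. side A u v \<and> card A = j)"
    using exists_least_iff[of "\<lambda>n. \<exists>A u v. side A u v \<and> card A = n"] by auto
  obtain A u v where A: "side A u v" "card A = n" using n by blast
  then obtain S B where sep: "separation V (E - {{u, v}}) S A B" "card S < k" "u \<in> A" "v \<in> B"
    and uv: "{u, v} \<in> D" by (auto simp: side_def)
  obtain f where f: "f \<in> D" "f \<noteq> {u, v}" "u \<in> f" using D(3)[OF uv, of u] by auto
  have "f \<in> E" "\<not> k_connected k V (E - {f})" using f(1) D(1) crit by blast+
  from critical_edge_separation[OF G this] obtain a b S1 A1 B1 where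
    c: "f = {a, b}" "a \<in> A1" "b \<in> B1" "card S1 < k" "separation V (E - {f}) S1 A1 B1" by blast
  have "\<exists>w S' A' B'. f = {u, w} \<and> u \<in> A' \<and> w \<in> B' \<and> card S' < k \<and> separation V (E - {f}) S' A' B'"
  proof (cases "u = a")
    case True
    then show ?thesis using c by blast
  next
    case False
    then have "f = {u, a}" "u = b" using f(3) c(1) by auto
    then show ?thesis using c separation_sym[OF c(5)] by blast
  qed
  then obtain w S' A' B' where f': "f = {u, w}" "u \<in> A'" "w \<in> B'" "card S' < k"
    and sep': "separation V (E - {{u, w}}) S' A' B'" by blast
  have "{u, v} \<subseteq> V" using G(1) uv D(1) unfolding simple_graph_def by blast
  then have "u \<in> V" by blast
  then have "card B' < card A"
    using critical_sides_uncross[OF G deg sep sep' f'(4,2,3)] uv f f' D(1) by auto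
  moreover have "side B' w u"
    using f f' separation_sym[OF sep'] by (auto simp: side_def insert_commute)
  ultimately show False using min A(2) by blast
qed

section \<open>Enlarging a removable matching\<close>

text \<open>
  The vertex \<open>p\<close> has at most two neighbours in \<open>R\<close>, so it misses at most two of the at most \<open>d\<close>
  vertices outside \<open>R\<close>. On the other side \<open>A\<close> it has only the neighbour \<open>q\<close>, so \<open>A\<close> contains at
  most three vertices outside \<open>R\<close>. A vertex of \<open>A \<inter> R\<close> with at most one neighbour in \<open>A \<inter> R\<close> has
  at most three neighbours in \<open>A - R\<close>, \<open>k - 1\<close> in \<open>S\<close> and one in \<open>B\<close>,
  altogether at most \<open>k + 4 < 3 * k - 1\<close>.
\<close>

lemma no_crossing_at_low_vertex:
  assumes G: "simple_graph V E" and deg: "\<And>v. v \<in> V \<Longrightarrow> d \<le> card (nbrs E v)"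
    and d: "3 * k - 1 \<le> d" "k \<ge> 4"
    and R: "R \<subseteq> V" "card (V - R) \<le> d"
    and forest: "\<And>W. W \<subseteq> R \<Longrightarrow> W \<noteq> {} \<Longrightarrow> \<exists>v\<in>W. card (nbrs E v \<inter> W) \<le> 1"
    and M: "disjoint M" "separation V (E - M) S A B" "card S < k"
    and pq: "{p, q} \<in> M" "p \<in> R" "p \<in> B" "q \<in> A" "card (nbrs E p \<inter> R) \<le> 2"
  shows False
proof -
  note s = separation_parts[OF M(2)]
  have finV: "finite V" using G by (simp add: simple_graph_def)
  have fin: "finite X" if "X \<subseteq> V" for X using that finV finite_subset by blast
  note fN = finite_nbrs[OF G] and sN = nbrs_subset[OF G]
  have sub: "S \<subseteq> V" "A \<subseteq> V" "B \<subseteq> V" using s(1) by blast+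
  have across: "card (nbrs E v \<inter> B) \<le> 1" if "v \<in> A" for v
  proof -
    have "nbrs E v \<inter> B \<subseteq> nbrs M v" using s(7) that by (auto simp: nbrs_def)
    moreover have "finite (nbrs E v \<inter> B)" using fN by blast
    ultimately have "a = b" if "a \<in> nbrs E v \<inter> B" "b \<in> nbrs E v \<inter> B" for a b
      using that matching_nbr_unique[OF M(1), of v a b] unfolding nbrs_def by blast
    then show ?thesis using \<open>finite (nbrs E v \<inter> B)\<close> by (auto simp: card_le_Suc0_iff_eq)
  qed
  have degA: "d \<le> card (nbrs E v \<inter> A) + k" if "v \<in> A" for v
  proof -
    have "card (nbrs E v) = card (nbrs E v \<inter> S) + card (nbrs E v \<inter> A) + card (nbrs E v \<inter> B)"
      by (rule card_eq_sum3) (use fN sN s(1-4) in auto)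
    moreover have "card (nbrs E v \<inter> S) \<le> card S" using fin sub by (intro card_mono) auto
    moreover have "d \<le> card (nbrs E v)" using deg that sub by blast
    ultimately show ?thesis using across[OF that] M(3) by linarith
  qed
  have "p \<in> V" using pq R by blast
  have "card (nbrs E p) = card (nbrs E p \<inter> R) + card (nbrs E p \<inter> (V - R)) + card (nbrs E p \<inter> {})"
    by (rule card_eq_sum3) (use fN sN in auto)
  then have "d \<le> 2 + card (nbrs E p \<inter> (V - R))" using pq(5) deg[OF \<open>p \<in> V\<close>] by simp
  moreover have "card (V - R) = card ((V - R) \<inter> nbrs E p) + card ((V - R) - nbrs E p)"
    using finV by (simp add: card_Int_Diff)
  ultimately have miss: "card ((V - R) - nbrs E p) \<le> 2"
    using R(2) by (simp add: Int_commute)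
  have "A - R \<subseteq> insert q ((V - R) - nbrs E p)"
  proof
    fix z assume z: "z \<in> A - R"
    have "z = q" if "z \<in> nbrs E p"
    proof -
      have "{z, p} \<in> M" using that z pq(3) s(7)[of z p] by (auto simp: nbrs_def insert_commute)
      then show ?thesis using matching_nbr_unique[OF M(1), of p z q] pq(1) by (simp add: insert_commute)
    qed
    then show "z \<in> insert q ((V - R) - nbrs E p)" using z sub by blast
  qed
  then have "card (A - R) \<le> card (insert q ((V - R) - nbrs E p))"
    using finV by (intro card_mono) auto
  then have AR: "card (A - R) \<le> 3" using miss finV by (simp add: card_insert_if split: if_splits)
  \<comment> \<open>The side \<open>A\<close> contains at least \<open>d - k > 3\<close> neighbours of \<open>q\<close>, hence some vertex of \<open>R\<close>.\<close>
  have "card (nbrs E q \<inter> A) \<le> card A" using fin sub by (intro card_mono) auto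
  then have "card A > 3" using degA[OF pq(4)] d by linarith
  then have "\<not> A \<subseteq> A - R" using AR card_mono[of "A - R" A] fin[of "A - R"] sub by fastforce
  then have "A \<inter> R \<noteq> {}" by blast
  then obtain v where v: "v \<in> A \<inter> R" "card (nbrs E v \<inter> (A \<inter> R)) \<le> 1"
    using forest[of "A \<inter> R"] by blast
  have "nbrs E v \<inter> A \<subseteq> (nbrs E v \<inter> (A \<inter> R)) \<union> (A - R)" by blast
  then have "card (nbrs E v \<inter> A) \<le> card ((nbrs E v \<inter> (A \<inter> R)) \<union> (A - R))"
    using fN fin[of "A - R"] sub by (intro card_mono) auto
  also have "\<dots> \<le> card (nbrs E v \<inter> (A \<inter> R)) + card (A - R)" by (rule card_Un_le)
  finally have "card (nbrs E v \<inter> A) \<le> 4" using v(2) AR by linarith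
  moreover have "d \<le> card (nbrs E v \<inter> A) + k" using degA v(1) by blast
  ultimately show False using d by linarith
qed

text \<open>
  If no edge between uncovered vertices can be added, these vertices span a forest, and one edge
  \<open>ab\<close> of \<open>M\<close> is exchanged for two edges \<open>xa\<close>, \<open>yb\<close> with \<open>x\<close>, \<open>y\<close> near the ends of this forest.
\<close>

lemma enlarge_removable_matching:
  assumes G: "simple_graph V E" and kc: "k_connected k V E"
    and deg: "\<And>v. v \<in> V \<Longrightarrow> d \<le> card (nbrs E v)"
    and d: "3 * k - 1 \<le> d" "k \<ge> 4"
    and M: "k_removable k V E M" "2 * card M \<le> d" "2 * card M + 2 \<le> card V"
  shows "\<exists>M'. k_removable k V E M' \<and> card M' = Suc (card M)"
proof (rule ccontr)
  assume stuck: "\<not> ?thesis"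
  have ME: "M \<subseteq> E" and Md: "disjoint M" and H: "k_connected k V (E - M)"
    using M(1) by (auto simp: k_removable_def matching_def)
  have finV: "finite V" using G by (simp add: simple_graph_def)
  have "E \<subseteq> Pow V" using G by (auto simp: simple_graph_def)
  then have finM: "finite M" using ME finV by (meson finite_Pow_iff finite_subset)
  define R where "R = V - \<Union>M"
  have MV: "\<Union>M \<subseteq> V" using ME G by (auto simp: simple_graph_def)
  have cM: "card (\<Union>M) = 2 * card M" by (rule card_Union_matching[OF G ME Md])
  have VR: "V - R = \<Union>M" using MV by (auto simp: R_def)
  have cR: "card R + 2 * card M = card V"
    using card_Diff_subset[OF finite_subset[OF MV finV] MV] card_mono[OF finV MV] cM
    unfolding R_def by linarith
  note fN = finite_nbrs[OF G] and sN = nbrs_subset[OF G]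
  have k1: "k \<ge> 1" using d by simp
  have sH: "simple_graph V (E - M)" by (rule simple_graph_mono[OF G]) blast
  have degH: "k < card (nbrs (E - M) v)" if "v \<in> V" for v
  proof -
    have "nbrs E v \<subseteq> nbrs (E - M) v \<union> nbrs M v" by (auto simp: nbrs_def)
    then have "card (nbrs E v) \<le> card (nbrs (E - M) v \<union> nbrs M v)"
      using finite_nbrs[OF sH] finite_nbrs[OF simple_graph_mono[OF G ME]] by (intro card_mono) auto
    also have "\<dots> \<le> card (nbrs (E - M) v) + card (nbrs M v)" by (rule card_Un_le)
    finally show ?thesis
      using deg[OF that] card_matching_nbrs_le[OF Md, of v] d by linarith
  qed

  \<comment> \<open>A set \<open>W\<close> in which every vertex has two neighbours would contain an edge that can be added.\<close>
  have forest: "\<exists>v\<in>W. card (nbrs E v \<inter> W) \<le> 1" if W: "W \<subseteq> R" "W \<noteq> {}" for W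
  proof (rule ccontr)
    assume many: "\<not> ?thesis"
    define D where "D = {{u, v} | u v. u \<in> W \<and> v \<in> W \<and> {u, v} \<in> E}"
    have two: "\<exists>w. w \<in> W \<and> {u, w} \<in> E \<and> w \<noteq> v" if "u \<in> W" for u v
    proof (rule ccontr)
      assume "\<not> ?thesis"
      then have "nbrs E u \<inter> W \<subseteq> {v}" by (auto simp: nbrs_def)
      then have "card (nbrs E u \<inter> W) \<le> card {v}" by (intro card_mono) auto
      then show False using many that by auto
    qed
    have DE: "D \<subseteq> E - M" using W by (auto simp: D_def R_def)
    have Dne: "D \<noteq> {}" using W(2) two by (fastforce simp: D_def)
    have Dcyc: "\<exists>f\<in>D. f \<noteq> e \<and> u \<in> f" if "e \<in> D" "u \<in> e" for e u
    proof -
      obtain s t where "e = {s, t}" "s \<in> W" "t \<in> W" "{s, t} \<in> E"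
        using \<open>e \<in> D\<close> unfolding D_def by blast
      then obtain v where v: "e = {u, v}" "u \<in> W" using \<open>u \<in> e\<close> by blast
      obtain w where "w \<in> W" "{u, w} \<in> E" "w \<noteq> v" using two[OF v(2), of v] by blast
      then have "{u, w} \<in> D" using v(2) unfolding D_def by blast
      moreover have "{u, w} \<noteq> e" using v(1) \<open>w \<noteq> v\<close> by (auto simp: doubleton_eq_iff)
      ultimately show ?thesis by (intro bexI[of _ "{u, w}"]) simp_all
    qed
    have "\<exists>e\<in>D. k_connected k V (E - M - {e})"
      by (rule exists_noncritical_edge[OF sH H k1 degH DE Dne Dcyc])
    then obtain e where e: "e \<in> D" "k_connected k V (E - M - {e})" by blast
    have eR: "e \<subseteq> R" "e \<in> E" "e \<noteq> {}" using e(1) W(1) by (auto simp: D_def)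
    then have "e \<notin> M" unfolding R_def by blast
    have "disjoint (insert e M)"
      using Md eR(1) unfolding R_def pairwise_insert disjnt_def by blast
    moreover have "E - insert e M = E - M - {e}" by blast
    ultimately have "k_removable k V E (insert e M)"
      using e(2) ME eR by (auto simp: k_removable_def matching_def)
    then show False using stuck \<open>e \<notin> M\<close> finM by auto
  qed

  have "R \<noteq> {}" using cR M(3) by auto
  then obtain x where x: "x \<in> R" "card (nbrs E x \<inter> R) \<le> 1" using forest[of R] by blast
  \<comment> \<open>The vertex \<open>y\<close> is an end of the forest without \<open>x\<close>; its second neighbour in \<open>R\<close> may be \<open>x\<close>.\<close>
  have "R - {x} \<noteq> {}"
  proof
    assume "R - {x} = {}"
    then have "card R \<le> card {x}" by (intro card_mono) auto
    then show False using cR M(3) by simp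
  qed
  then obtain y where y: "y \<in> R" "y \<noteq> x" "card (nbrs E y \<inter> (R - {x})) \<le> 1"
    using forest[of "R - {x}"] by blast
  have "card (nbrs E y \<inter> R) \<le> card (insert x (nbrs E y \<inter> (R - {x})))"
    using fN by (intro card_mono) auto
  then have y2: "card (nbrs E y \<inter> R) \<le> 2" using y(3) fN by (simp add: card_insert_if split: if_splits)

  have covered: "d \<le> card (nbrs E v \<inter> R) + card (nbrs E v \<inter> \<Union>M)" if "v \<in> R" for v
  proof -
    have "card (nbrs E v) = card (nbrs E v \<inter> R) + card (nbrs E v \<inter> \<Union>M) + card (nbrs E v \<inter> {})"
      by (rule card_eq_sum3) (use fN sN in \<open>auto simp: R_def\<close>)
    moreover have "d \<le> card (nbrs E v)" using deg that by (auto simp: R_def)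
    ultimately show ?thesis by simp
  qed
  have finU: "finite (\<Union>M)" using MV finV finite_subset by blast
  have missed: "card (\<Union>M - nbrs E v) \<le> 2" if "v \<in> R" "card (nbrs E v \<inter> R) \<le> 2" for v
    using covered[OF that(1)] that(2) cM M(2) card_Int_Diff[OF finU, of "nbrs E v"]
    by (simp add: Int_commute)
  \<comment> \<open>The vertices missed by \<open>x\<close> or \<open>y\<close> are at most four and cannot meet all edges of \<open>M\<close>:
    since \<open>x\<close> has at least \<open>d - 1 \<ge> 3 * k - 2 \<ge> 10\<close> covered neighbours, \<open>M\<close> has at least five edges.\<close>
  have "card (nbrs E x \<inter> \<Union>M) \<le> card (\<Union>M)" using finU by (intro card_mono) auto
  then have "card M \<ge> 5" using covered[OF x(1)] x(2) cM d by linarith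
  moreover have "card ((\<Union>M - nbrs E x) \<union> (\<Union>M - nbrs E y)) \<le> 4"
    using card_Un_le[of "\<Union>M - nbrs E x" "\<Union>M - nbrs E y"] missed[OF x(1)] missed[OF y(1) y2] x(2)
    by linarith
  ultimately obtain e where e: "e \<in> M" "e \<inter> ((\<Union>M - nbrs E x) \<union> (\<Union>M - nbrs E y)) = {}"
    using exists_matching_edge_avoiding[OF Md finM, of "(\<Union>M - nbrs E x) \<union> (\<Union>M - nbrs E y)"] finU
    by fastforce
  have "card e = 2" using e(1) ME G by (auto simp: simple_graph_def)
  then obtain a b where ab: "e = {a, b}" "a \<noteq> b" by (meson card_2_iff)
  have abM: "a \<in> \<Union>M" "b \<in> \<Union>M" using e(1) ab by auto
  then have xa: "{x, a} \<in> E" and yb: "{y, b} \<in> E" using e(2) ab by (auto simp: nbrs_def)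
  have xy: "x \<notin> \<Union>M" "y \<notin> \<Union>M" using x(1) y(1) by (auto simp: R_def)

  define M' where "M' = insert {x, a} (insert {y, b} (M - {e}))"
  have M'E: "M' \<subseteq> E" using ME xa yb by (auto simp: M'_def)
  have off: "a \<notin> f" "b \<notin> f" "x \<notin> f" "y \<notin> f" if "f \<in> M - {e}" for f
    using that xy disjoint_edges_eq[OF Md, of f e] e(1) ab by auto
  have "x \<noteq> b" "y \<noteq> a" using xy abM by auto
  have M'd: "disjoint M'"
    unfolding M'_def
  proof (intro pairwise_insert[THEN iffD2] conjI allI impI)
    show "pairwise disjnt (M - {e})" using Md by (rule pairwise_subset) blast
  qed (use off ab y(2) \<open>x \<noteq> b\<close> \<open>y \<noteq> a\<close> in \<open>auto simp: disjnt_def\<close>)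
  have "{x, a} \<notin> insert {y, b} (M - {e})" "{y, b} \<notin> M - {e}"
    using off y(2) \<open>x \<noteq> b\<close> by (auto simp: doubleton_eq_iff)
  then have cM': "card M' = Suc (card M)"
    using finM e(1) card_gt_0_iff[of M] by (auto simp: M'_def)
  \<comment> \<open>Some edge of the \<open>k\<close>-connected graph \<open>G - M\<close> crosses a small separation of \<open>G - M'\<close>;
    it can only be one of the two new edges.\<close>
  have "k \<le> card S" if sep: "separation V (E - M') S A B" for S A B
  proof (rule ccontr)
    assume "\<not> k \<le> card S"
    then have small: "card S < k" by simp
    then have "\<not> separation V (E - M) S A B"
      using separation_card_ge[OF sH H k1] by fastforce
    then obtain s t where st: "s \<in> A" "t \<in> B" "{s, t} \<in> E" "{s, t} \<notin> M"
      using sep by (auto simp: separation_def)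
    then have "{s, t} \<in> M'" using separation_parts(7)[OF sep] by blast
    then have "{s, t} = {x, a} \<or> {s, t} = {y, b}" using st(4) by (auto simp: M'_def)
    then obtain p q where pq: "{s, t} = {p, q}" "{p, q} \<in> M'" "p \<in> R" "card (nbrs E p \<inter> R) \<le> 2"
      using x y(1) y2 by (auto simp: M'_def)
    have RV: "R \<subseteq> V" "card (V - R) \<le> d" using VR cM M(2) by (auto simp: R_def)
    note contra = no_crossing_at_low_vertex[OF G deg d RV forest M'd]
    consider "p = t" "q = s" | "p = s" "q = t" using pq(1) by (auto simp: doubleton_eq_iff)
    then show False
    proof cases
      case 1
      then show False using contra[OF _ _ _ sep small pq(2,3)] st pq(4) by blast
    next
      case 2
      then show False using contra[OF _ _ _ separation_sym[OF sep] small pq(2,3)] st pq(4) by blast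
    qed
  qed
  moreover have "card V > k" using kc by (simp add: k_connected_def)
  ultimately have "k_connected k V (E - M')" using finV k1 by (intro k_connectedI)
  then have "k_removable k V E M'" using M'E M'd by (simp add: k_removable_def matching_def)
  then show False using stuck cM' by blast
qed

section \<open>The number of removable edges\<close>

text \<open>
  As long as \<open>2|M| \<le> \<delta>\<close>, two vertices are left uncovered: otherwise the order is
  \<open>\<delta> + 1 = 2|M| + 1\<close>, so that the graph is complete and has odd order.
\<close>

theorem theorem1p8:
  fixes V :: "'a set" and E :: "'a set set" and k :: nat
  assumes "k \<ge> 4"
    and "simple_graph V E"
    and "k_connected k V E"
    and "min_degree V E \<ge> 3 * k - 1"
    and "\<not> (complete_graph V E \<and> odd (card V))"
  shows "\<exists>M. k_removable k V E M \<and>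
             int (card M) = \<lceil>(real (min_degree V E) + 1) / 2\<rceil>"
proof -
  note G = assms(2)
  define d where "d = min_degree V E"
  have finV: "finite V" using G by (simp add: simple_graph_def)
  have "V \<noteq> {}" using assms(3) by (auto simp: k_connected_def)
  have deg: "d \<le> card (nbrs E v)" if "v \<in> V" for v
    using that finV by (simp add: d_def min_degree_def flip: degree_eq_card_nbrs[OF G])
  have nb: "nbrs E v \<subseteq> V - {v}" for v
    using nbrs_subset[OF G, of v] not_self_nbr[OF G] by (auto simp: nbrs_def)
  have order: "d + 1 \<le> card V"
  proof -
    obtain v where v: "v \<in> V" using \<open>V \<noteq> {}\<close> by blast
    have "card (nbrs E v) \<le> card (V - {v})" using nb finV by (intro card_mono) auto
    moreover have "card V > 0" using finV v by (auto simp: card_gt_0_iff)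
    ultimately show ?thesis using deg[OF v] v finV by simp
  qed
  have complete: "complete_graph V E" if "card V = d + 1"
  proof -
    have "nbrs E v = V - {v}" if "v \<in> V" for v
      by (rule card_seteq) (use nb finV deg[OF that] \<open>card V = d + 1\<close> that in auto)
    then have "{u, v} \<in> E" if "u \<in> V" "v \<in> V" "u \<noteq> v" for u v
      using that by (auto simp: nbrs_def)
    then have "e \<in> E" if "e \<subseteq> V" "card e = 2" for e
      using that by (auto simp: card_2_iff)
    then show ?thesis using G by (auto simp: complete_graph_def simple_graph_def)
  qed
  have ex: "\<exists>M. k_removable k V E M \<and> card M = j" if "j \<le> (d + 2) div 2" for j
    using that
  proof (induction j)
    case 0
    have "k_removable k V E {}" using assms(3) by (simp add: k_removable_def matching_def)
    then show ?case by (metis card.empty)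
  next
    case (Suc j)
    then obtain M where M: "k_removable k V E M" "card M = j" by auto
    have j: "2 * j \<le> d" using Suc.prems by simp
    have "2 * j + 2 \<le> card V"
    proof (rule ccontr)
      assume "\<not> ?thesis"
      then have "card V = d + 1" "card V = 2 * j + 1" using order j by linarith+
      moreover from this(2) have "odd (card V)" by simp
      ultimately show False using complete assms(5) by blast
    qed
    then show ?case
      using enlarge_removable_matching[OF G assms(3) deg _ assms(1) M(1)] assms(4) M(2) j
      by (auto simp: d_def)
  qed
  obtain M where M: "k_removable k V E M" "card M = (d + 2) div 2" using ex by blast
  have "int ((d + 2) div 2) = \<lceil>(real d + 1) / 2\<rceil>"
    by (rule ceiling_unique[symmetric]) (cases "even d"; auto elim!: evenE oddE)+
  then show ?thesis using M by (auto simp: d_def)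
qed

end
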